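(* Let $H$ be a separable infinite-dimensional complex Hilbert space and let $T\in L(H)$ be a completely non-unitary contraction. If $T$ has a non-trivial algebraic element $h$, i.e. there exist $h\in H$ with $h\neq 0$ and $\theta\in H^{\infty}\setminus\{0\}$ such that $\theta(T)h=0$, then $T$ has a non-trivial invariant subspace.
   Context: $L(H)$ is the set of bounded linear operators from $H$ to $H$. A contraction is an operator $T\in L(H)$ with $\|T\|\le 1$; it is completely non-unitary if its restriction to any non-zero reducing subspace is never unitary. $H^{\infty}$ is the Banach space of bounded analytic complex-valued functions on the open unit disk $\mathbf{D}$ with the supremum norm. For a completely non-unitary contraction $T$ there is a unique algebra representation $\Phi_T:H^\infty\to L(H)$ (the Sz.-Nagy--Foias functional calculus) such that $\Phi_T(1)=I_H$; $\Phi_T(g)=T$ for $g(z)=z$; $\Phi_T$ is continuous when $H^\infty$ and $L(H)$ are given their weak$^*$ topologies; and $\|\Phi_T(u)\|\le\|u\|$ for all $u\in H^\infty$. One writes $u(T)=\Phi_T(u)$. An element $h\in H$ is algebraic with respect to $T$ if $\theta(T)h=0$ for some $\theta\in H^\infty\setminus\{0\}$; it is a non-trivial algebraic element if in addition $h\ne 0$. A non-trivial invariant subspace of $T$ is a closed linear subspace $M\subseteq H$ with $TM\subseteq M$, $M\neq\{0\}$ and $M\neq H$. *)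

theory Defs
  imports "HOL-Analysis.Analysis" "HOL-Complex_Analysis.Complex_Analysis"
begin

section \<open>Complex Hilbert spaces\<close>

class scaleC =
  fixes scaleC :: "complex \<Rightarrow> 'a \<Rightarrow> 'a"  (infixr \<open>*\<^sub>C\<close> 75)

class complex_vector = real_vector + scaleC +
  assumes scaleC_add_right: "a *\<^sub>C (x + y) = a *\<^sub>C x + a *\<^sub>C y"
    and scaleC_add_left: "(a + b) *\<^sub>C x = a *\<^sub>C x + b *\<^sub>C x"
    and scaleC_scaleC: "a *\<^sub>C (b *\<^sub>C x) = (a * b) *\<^sub>C x"
    and scaleC_one: "1 *\<^sub>C x = x"
    and scaleR_scaleC: "r *\<^sub>R x = complex_of_real r *\<^sub>C x"

global_interpretation complex_vector:
  vector_space "scaleC :: complex \<Rightarrow> 'a \<Rightarrow> 'a::complex_vector"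
  defines csubspace_raw_def: csubspace = complex_vector.subspace
    and cspan_raw_def: cspan = complex_vector.span
  by unfold_locales
    (simp_all add: scaleC_add_right scaleC_add_left scaleC_scaleC scaleC_one)

text \<open>
  The complex inner product is linear in its first argument. Its real part is the inner product
  of the underlying real inner product space, so \<open>(norm x)\<^sup>2 = cinner x x\<close>, and the norm, the
  topology and the type of bounded linear operators are those of the library.
\<close>

class complex_inner = complex_vector + real_inner +
  fixes cinner :: "'a \<Rightarrow> 'a \<Rightarrow> complex"
  assumes cinner_commute: "cinner x y = cnj (cinner y x)"
    and cinner_add_left: "cinner (x + y) z = cinner x z + cinner y z"
    and cinner_scaleC_left: "cinner (a *\<^sub>C x) y = a * cinner x y"
    and Re_cinner: "Re (cinner x y) = inner x y"

class complex_hilbert_space = complex_inner + complete_space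
begin
subclass banach ..
end

definition infinite_dimensional :: "'a::complex_vector itself \<Rightarrow> bool" where
  "infinite_dimensional _ \<longleftrightarrow> \<not> (\<exists>B :: 'a set. finite B \<and> cspan B = UNIV)"

section \<open>Operators\<close>

text \<open>The type \<open>'a \<Rightarrow>\<^sub>L 'a\<close> consists of the real-linear bounded operators, with the operator norm.\<close>

definition bounded_operators :: "('a::complex_hilbert_space \<Rightarrow>\<^sub>L 'a) set" where
  "bounded_operators = {T. \<forall>c x. blinfun_apply T (c *\<^sub>C x) = c *\<^sub>C blinfun_apply T x}"

definition contraction :: "('a::complex_hilbert_space \<Rightarrow>\<^sub>L 'a) \<Rightarrow> bool" where
  "contraction T \<longleftrightarrow> T \<in> bounded_operators \<and> norm T \<le> 1"

definition closed_csubspace :: "'a::complex_hilbert_space set \<Rightarrow> bool" where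
  "closed_csubspace M \<longleftrightarrow> csubspace M \<and> closed M"

definition invariant_subspace :: "('a::complex_hilbert_space \<Rightarrow>\<^sub>L 'a) \<Rightarrow> 'a set \<Rightarrow> bool" where
  "invariant_subspace T M \<longleftrightarrow> closed_csubspace M \<and> blinfun_apply T ` M \<subseteq> M"

definition nontrivial_invariant_subspace ::
    "('a::complex_hilbert_space \<Rightarrow>\<^sub>L 'a) \<Rightarrow> 'a set \<Rightarrow> bool" where
  "nontrivial_invariant_subspace T M \<longleftrightarrow> invariant_subspace T M \<and> M \<noteq> {0} \<and> M \<noteq> UNIV"

definition ortho_complement :: "'a::complex_hilbert_space set \<Rightarrow> 'a set" where
  "ortho_complement M = {x. \<forall>y\<in>M. cinner x y = 0}"

definition reducing_subspace :: "('a::complex_hilbert_space \<Rightarrow>\<^sub>L 'a) \<Rightarrow> 'a set \<Rightarrow> bool" where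
  "reducing_subspace T M \<longleftrightarrow>
     invariant_subspace T M \<and> invariant_subspace T (ortho_complement M)"

definition unitary_on :: "'a::complex_hilbert_space set \<Rightarrow> ('a \<Rightarrow>\<^sub>L 'a) \<Rightarrow> bool" where
  "unitary_on M T \<longleftrightarrow> blinfun_apply T ` M = M \<and>
     (\<forall>x\<in>M. \<forall>y\<in>M. cinner (blinfun_apply T x) (blinfun_apply T y) = cinner x y)"

definition completely_nonunitary :: "('a::complex_hilbert_space \<Rightarrow>\<^sub>L 'a) \<Rightarrow> bool" where
  "completely_nonunitary T \<longleftrightarrow>
     (\<forall>M. reducing_subspace T M \<and> M \<noteq> {0} \<longrightarrow> \<not> unitary_on M T)"

text \<open>
  The weak* topology of the operators as the dual of the trace class. The trace class operators
  are the sums \<open>\<Sum>n. cinner _ (y n) *\<^sub>C x n\<close> with \<open>x\<close>, \<open>y\<close> square summable sequences of vectors,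
  and the trace of the product of \<open>T\<close> with such an operator is \<open>\<Sum>n. cinner (T (x n)) (y n)\<close>.
\<close>

definition square_summable :: "(nat \<Rightarrow> 'a::complex_hilbert_space) set" where
  "square_summable = {x. summable (\<lambda>n. (norm (x n))\<^sup>2)}"

definition trace_pairing ::
    "('a::complex_hilbert_space \<Rightarrow>\<^sub>L 'a) \<Rightarrow> (nat \<Rightarrow> 'a) \<times> (nat \<Rightarrow> 'a) \<Rightarrow> complex" where
  "trace_pairing T = (\<lambda>(x, y). \<Sum>n. cinner (blinfun_apply T (x n)) (y n))"

definition weak_star_operators :: "('a::complex_hilbert_space \<Rightarrow>\<^sub>L 'a) topology" where
  "weak_star_operators =
     pullback_topology bounded_operators
       (\<lambda>T. \<lambda>p\<in>square_summable \<times> square_summable. trace_pairing T p)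
       (product_topology (\<lambda>_. euclidean) (square_summable \<times> square_summable))"

section \<open>Bounded analytic functions on the unit disk\<close>

text \<open>
  Elements of \<open>H\<^sup>\<infinity>\<close> are represented by functions on the whole plane; the values outside the
  open unit disk are irrelevant, and two functions that agree on the disk represent the same element.
\<close>

definition Hinf :: "(complex \<Rightarrow> complex) set" where
  "Hinf = {u. u holomorphic_on ball 0 1 \<and> bounded (u ` ball 0 1)}"

definition Hinf_norm :: "(complex \<Rightarrow> complex) \<Rightarrow> real" where
  "Hinf_norm u = (SUP z\<in>ball 0 1. cmod (u z))"

definition Hinf_nonzero :: "(complex \<Rightarrow> complex) \<Rightarrow> bool" where
  "Hinf_nonzero u \<longleftrightarrow> (\<exists>z\<in>ball 0 1. u z \<noteq> 0)"

text \<open>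
  The weak* topology of \<open>H\<^sup>\<infinity>\<close> as a subspace of \<open>L\<^sup>\<infinity>\<close> of the unit circle, that is, as the
  dual of \<open>L\<^sup>1\<close> of the circle modulo the annihilator of \<open>H\<^sup>\<infinity>\<close>. The pairing of \<open>u\<close> with an
  integrable \<open>f\<close> is the normalised integral of the boundary function of \<open>u\<close> against \<open>f\<close>. By
  Fatou's theorem and dominated convergence this is the limit below, which always exists.
\<close>

definition circle_L1 :: "(real \<Rightarrow> complex) set" where
  "circle_L1 = {f. set_integrable lborel {0..2 * pi} f}"

definition Hinf_pairing :: "(complex \<Rightarrow> complex) \<Rightarrow> (real \<Rightarrow> complex) \<Rightarrow> complex" where
  "Hinf_pairing u f =
     Lim (at_left (1::real))
       (\<lambda>r. (LINT t:{0..2 * pi}|lborel. u (complex_of_real r * cis t) * f t)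
             / complex_of_real (2 * pi))"

definition weak_star_Hinf :: "(complex \<Rightarrow> complex) topology" where
  "weak_star_Hinf =
     pullback_topology Hinf (\<lambda>u. \<lambda>f\<in>circle_L1. Hinf_pairing u f)
       (product_topology (\<lambda>_. euclidean) circle_L1)"

section \<open>The Sz.-Nagy--Foias functional calculus\<close>

text \<open>
  For a completely non-unitary contraction \<open>T\<close> there is exactly one such \<open>\<Phi>\<close> on \<open>H\<^sup>\<infinity>\<close>.
  By linearity and the norm bound, \<open>\<Phi> u\<close> depends only on the values of \<open>u\<close> in the disk. That \<open>\<Phi>\<close>
  takes values in the complex-linear operators is part of the continuity condition.
\<close>

definition functional_calculus ::
    "('a::complex_hilbert_space \<Rightarrow>\<^sub>L 'a) \<Rightarrow> ((complex \<Rightarrow> complex) \<Rightarrow> ('a \<Rightarrow>\<^sub>L 'a)) \<Rightarrow> bool" where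
  "functional_calculus T \<Phi> \<longleftrightarrow>
     (\<forall>u\<in>Hinf. \<forall>v\<in>Hinf. \<Phi> (\<lambda>z. u z + v z) = \<Phi> u + \<Phi> v) \<and>
     (\<forall>c. \<forall>u\<in>Hinf. \<forall>x. blinfun_apply (\<Phi> (\<lambda>z. c * u z)) x = c *\<^sub>C blinfun_apply (\<Phi> u) x) \<and>
     (\<forall>u\<in>Hinf. \<forall>v\<in>Hinf. \<Phi> (\<lambda>z. u z * v z) = \<Phi> u o\<^sub>L \<Phi> v) \<and>
     \<Phi> (\<lambda>_. 1) = id_blinfun \<and>
     \<Phi> (\<lambda>z. z) = T \<and>
     continuous_map weak_star_Hinf weak_star_operators \<Phi> \<and>
     (\<forall>u\<in>Hinf. norm (\<Phi> u) \<le> Hinf_norm u)"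

text \<open>Here \<open>\<Phi>\<close> is the functional calculus of the operator, so that \<open>\<Phi> \<theta>\<close> is \<open>\<theta>(T)\<close>.\<close>

definition algebraic_element ::
    "((complex \<Rightarrow> complex) \<Rightarrow> ('a::complex_hilbert_space \<Rightarrow>\<^sub>L 'a)) \<Rightarrow> 'a \<Rightarrow> bool" where
  "algebraic_element \<Phi> h \<longleftrightarrow>
     (\<exists>\<theta>\<in>Hinf. Hinf_nonzero \<theta> \<and> blinfun_apply (\<Phi> \<theta>) h = 0)"

definition nontrivial_algebraic_element ::
    "((complex \<Rightarrow> complex) \<Rightarrow> ('a::complex_hilbert_space \<Rightarrow>\<^sub>L 'a)) \<Rightarrow> 'a \<Rightarrow> bool" where
  "nontrivial_algebraic_element \<Phi> h \<longleftrightarrow> algebraic_element \<Phi> h \<and> h \<noteq> 0"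

end

theory Submission
  imports Defs
begin

text \<open>
  Suppose that \<open>T\<close> has no non-trivial invariant subspace. The kernel of \<open>u(T)\<close> is a closed invariant
  subspace for every \<open>u\<close> in \<open>H\<^sup>\<infinity>\<close>, so \<open>u(T)\<close> is either zero or injective (\<open>kernel_trivial\<close>). Two things
  follow. The function \<open>\<theta>\<close> that annihilates the algebraic element annihilates the whole space, that
  is, \<open>\<theta>(T) = 0\<close>. And the annihilator \<open>J = {u. u(T) = 0}\<close> is a prime ideal (\<open>mult_eq_0\<close>).
  It contains no \<open>z - l\<close>, because in infinite dimension a multiple of the identity has plenty of
  invariant subspaces.

  A weak* closed prime ideal of this kind cannot exist, by an extremal argument in place of the
  factorisation into inner and outer functions. Choose \<open>z\<^sub>0\<close> with \<open>\<theta>(z\<^sub>0) \<noteq> 0\<close>. By Montel's theorem, and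
  because \<open>J\<close> is weak* closed, there is a \<open>g\<close> in \<open>J\<close> with \<open>\<bar>g\<bar> \<le> 1\<close> on the disk for which \<open>\<bar>g(z\<^sub>0)\<bar>\<close> is as
  large as possible (\<open>extremal_function_exists\<close>). It is not zero, since a multiple of \<open>\<theta>\<close> competes.

  If \<open>g\<close> had a zero \<open>l\<close>, the quotient of \<open>g\<close> by the Blaschke factor \<open>(z - l) / (1 - cnj l z)\<close> would still be
  bounded by 1, it would lie in \<open>J\<close> because \<open>J\<close> is prime, and it would be strictly larger than \<open>g\<close>
  at \<open>z\<^sub>0\<close> (\<open>divide_Blaschke_factor\<close>, \<open>Blaschke_factor_lt_1\<close>). So \<open>g\<close> is the square of a holomorphic \<open>u\<close>,
  which lies in \<open>J\<close>, again because \<open>J\<close> is prime. Hence \<open>\<bar>g(z\<^sub>0)\<bar>\<^bsup>1/2\<^esup> \<le> \<bar>g(z\<^sub>0)\<bar>\<close>, so \<open>\<bar>g(z\<^sub>0)\<bar> = 1\<close>, and \<open>g\<close> is constant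
  by the maximum modulus principle. But a non-zero constant does not lie in \<open>J\<close>.

  The analytic work is to show that a sequence in the unit ball of \<open>H\<^sup>\<infinity>\<close> that converges pointwise on
  the disk converges weak* (\<open>limitin_weak_star_Hinf\<close>). The pairing of \<open>u\<close> with \<open>f\<close> is the limit, as the
  radius tends to 1, of integrals of \<open>u\<close> against \<open>f\<close> over circles. For every integrable \<open>f\<close> this limit
  is uniform in \<open>u\<close> over the whole unit ball (\<open>uniformly_radial_circle_L1\<close>). Therefore the pairing can
  be computed, up to a small error, on one circle inside the disk, where dominated convergence applies.
\<close>

section \<open>Uniform radial limits of integrals over circles\<close>

definition Hinf_ball :: "(complex \<Rightarrow> complex) set" where
  "Hinf_ball = {u. u holomorphic_on ball 0 1 \<and> (\<forall>z\<in>ball 0 1. cmod (u z) \<le> 1)}"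

definition radial_integral :: "(complex \<Rightarrow> complex) \<Rightarrow> real \<Rightarrow> (real \<Rightarrow> complex) \<Rightarrow> complex" where
  "radial_integral u s f = (LINT t:{0..2 * pi}|lborel. u (complex_of_real s * cis t) * f t)"

text \<open>
  The Cauchy condition for the integrals over circles of radius \<open>s \<rightarrow> 1\<close>, with a threshold \<open>r\<close> common
  to all \<open>u\<close> in the unit ball. The uniformity does two jobs: it makes the defining limit of the pairing
  exist without Fatou's theorem, and it lets this limit be interchanged with limits in \<open>u\<close>.
\<close>

definition uniformly_radial :: "(real \<Rightarrow> complex) \<Rightarrow> bool" where
  "uniformly_radial f \<longleftrightarrow>
     (\<forall>e>0. \<exists>r. 0 < r \<and> r < 1 \<and> (\<forall>u\<in>Hinf_ball. \<forall>s\<in>{r<..<1}. \<forall>s'\<in>{r<..<1}.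
        cmod (radial_integral u s f - radial_integral u s' f) \<le> e))"

lemma Hinf_ball_Hinf: "u \<in> Hinf_ball \<Longrightarrow> u \<in> Hinf"
  by (auto simp: Hinf_ball_def Hinf_def bounded_iff)

lemma Hinf_ball_norm_le: "u \<in> Hinf_ball \<Longrightarrow> cmod z < 1 \<Longrightarrow> cmod (u z) \<le> 1"
  by (simp add: Hinf_ball_def)

lemma continuous_on_circle:
  assumes "u holomorphic_on ball 0 1" "0 < s" "s < 1"
  shows "continuous_on UNIV (\<lambda>t. u (complex_of_real s * cis t))"
  using assms
  by (intro continuous_on_compose2[OF holomorphic_on_imp_continuous_on[OF assms(1)]]
        continuous_intros) (auto simp: norm_mult)

lemma radial_integrable:
  assumes "u \<in> Hinf_ball" "0 < s" "s < 1" "integrable lborel f"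
  shows "integrable lborel (\<lambda>t. indicator {0..2 * pi} t *\<^sub>R (u (complex_of_real s * cis t) * f t))"
proof (rule Bochner_Integration.integrable_bound[OF assms(4)])
  have "(\<lambda>t. u (complex_of_real s * cis t)) \<in> borel_measurable borel"
    by (intro borel_measurable_continuous_onI continuous_on_circle)
      (use assms in \<open>auto simp: Hinf_ball_def\<close>)
  then show "(\<lambda>t. indicator {0..2 * pi} t *\<^sub>R (u (complex_of_real s * cis t) * f t))
      \<in> borel_measurable lborel"
    using borel_measurable_integrable[OF assms(4)] by measurable
  have "cmod (u (complex_of_real s * cis t)) \<le> 1" for t
    using assms by (intro Hinf_ball_norm_le) (auto simp: norm_mult)
  then show "AE t in lborel. norm (indicator {0..2 * pi} t *\<^sub>R (u (complex_of_real s * cis t) * f t))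
      \<le> norm (f t)"
    by (auto simp: norm_mult indicator_def mult_left_le_one_le)
qed

lemma radial_integral_diff:
  assumes "u \<in> Hinf_ball" "0 < s" "s < 1" "integrable lborel f" "integrable lborel g"
  shows "radial_integral u s (\<lambda>t. f t - g t) = radial_integral u s f - radial_integral u s g"
  unfolding radial_integral_def set_lebesgue_integral_def
  using radial_integrable[OF assms(1-4)] radial_integrable[OF assms(1-3,5)]
  by (simp add: ring_distribs scaleR_diff_right)

lemma norm_radial_integral_le:
  assumes "u \<in> Hinf_ball" "0 < s" "s < 1" "integrable lborel f"
  shows "cmod (radial_integral u s f) \<le> (LINT t|lborel. cmod (f t))"
  unfolding radial_integral_def set_lebesgue_integral_def
proof (rule Bochner_Integration.integral_norm_bound[THEN order_trans], rule integral_mono)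
  show "integrable lborel (\<lambda>t. norm (indicat_real {0..2 * pi} t *\<^sub>R (u (complex_of_real s * cis t) * f t)))"
    using radial_integrable[OF assms] by (rule integrable_norm)
  show "integrable lborel (\<lambda>t. cmod (f t))" using assms by simp
  fix t
  have "cmod (u (complex_of_real s * cis t)) \<le> 1"
    using assms by (intro Hinf_ball_norm_le) (auto simp: norm_mult)
  then show "norm (indicat_real {0..2 * pi} t *\<^sub>R (u (complex_of_real s * cis t) * f t)) \<le> norm (f t)"
    by (auto simp: norm_mult indicator_def mult_left_le_one_le)
qed

lemma uniformly_radial_add:
  assumes "integrable lborel f" "integrable lborel g" "uniformly_radial f" "uniformly_radial g"
  shows "uniformly_radial (\<lambda>t. f t + g t)"
  unfolding uniformly_radial_def
proof (intro allI impI)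
  fix e :: real assume "e > 0"
  then have "e/2 > 0" by simp
  obtain r1 where r1: "0 < r1" "r1 < 1" "\<forall>u\<in>Hinf_ball. \<forall>s\<in>{r1<..<1}. \<forall>s'\<in>{r1<..<1}.
      cmod (radial_integral u s f - radial_integral u s' f) \<le> e/2"
    using assms(3) \<open>e/2 > 0\<close> unfolding uniformly_radial_def by blast
  obtain r2 where r2: "0 < r2" "r2 < 1" "\<forall>u\<in>Hinf_ball. \<forall>s\<in>{r2<..<1}. \<forall>s'\<in>{r2<..<1}.
      cmod (radial_integral u s g - radial_integral u s' g) \<le> e/2"
    using assms(4) \<open>e/2 > 0\<close> unfolding uniformly_radial_def by blast
  have eq: "radial_integral u s (\<lambda>t. f t + g t) = radial_integral u s f + radial_integral u s g"
    if "u \<in> Hinf_ball" "0 < s" "s < 1" for u s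
    using radial_integral_diff[OF that, of "\<lambda>t. f t + g t" g] assms(1,2) by simp
  show "\<exists>r. 0 < r \<and> r < 1 \<and> (\<forall>u\<in>Hinf_ball. \<forall>s\<in>{r<..<1}. \<forall>s'\<in>{r<..<1}.
      cmod (radial_integral u s (\<lambda>t. f t + g t) - radial_integral u s' (\<lambda>t. f t + g t)) \<le> e)"
  proof (intro exI[of _ "max r1 r2"] conjI ballI)
    fix u s s' assume *: "u \<in> Hinf_ball" "s \<in> {max r1 r2<..<1}" "s' \<in> {max r1 r2<..<1}"
    have "cmod (radial_integral u s f - radial_integral u s' f) \<le> e/2"
      "cmod (radial_integral u s g - radial_integral u s' g) \<le> e/2"
      using r1 r2 * by auto
    then have "cmod ((radial_integral u s f - radial_integral u s' f)
        + (radial_integral u s g - radial_integral u s' g)) \<le> e"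
      by (intro order_trans[OF norm_triangle_ineq]) simp
    moreover have "radial_integral u s (\<lambda>t. f t + g t) - radial_integral u s' (\<lambda>t. f t + g t)
      = (radial_integral u s f - radial_integral u s' f)
        + (radial_integral u s g - radial_integral u s' g)"
      using * r1 by (subst (1 2) eq) auto
    ultimately show "cmod (radial_integral u s (\<lambda>t. f t + g t)
        - radial_integral u s' (\<lambda>t. f t + g t)) \<le> e" by simp
  qed (use r1 r2 in auto)
qed

lemma uniformly_radial_scale:
  assumes "uniformly_radial f"
  shows "uniformly_radial (\<lambda>t. c * f t)"
proof -
  have eq: "radial_integral u s (\<lambda>t. c * f t) = c * radial_integral u s f" for u s
    unfolding radial_integral_def set_lebesgue_integral_def integral_mult_right_zero[symmetric]
    by (intro Bochner_Integration.integral_cong) (auto simp: mult_ac)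
  show ?thesis
    unfolding uniformly_radial_def
  proof (intro allI impI)
    fix e :: real assume "e > 0"
    then have "e / (cmod c + 1) > 0" by (simp add: add_nonneg_pos)
    then obtain r where r: "0 < r" "r < 1" "\<forall>u\<in>Hinf_ball. \<forall>s\<in>{r<..<1}. \<forall>s'\<in>{r<..<1}.
        cmod (radial_integral u s f - radial_integral u s' f) \<le> e / (cmod c + 1)"
      using assms unfolding uniformly_radial_def by blast
    have "cmod (c * x) \<le> e" if "cmod x \<le> e / (cmod c + 1)" for x
    proof -
      have "cmod (c * x) \<le> (cmod c + 1) * cmod x" by (simp add: norm_mult mult_right_mono)
      also have "\<dots> \<le> (cmod c + 1) * (e / (cmod c + 1))" by (intro mult_left_mono that) simp
      also have "\<dots> = e" using norm_ge_zero[of c] by (simp add: add_nonneg_eq_0_iff)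
      finally show ?thesis .
    qed
    then show "\<exists>r. 0 < r \<and> r < 1 \<and> (\<forall>u\<in>Hinf_ball. \<forall>s\<in>{r<..<1}. \<forall>s'\<in>{r<..<1}.
        cmod (radial_integral u s (\<lambda>t. c * f t) - radial_integral u s' (\<lambda>t. c * f t)) \<le> e)"
      using r unfolding eq right_diff_distrib[symmetric] by blast
  qed
qed

text \<open>
  The integral against \<open>f\<close> changes by at most the \<open>L\<^sup>1\<close> distance when \<open>f\<close> is replaced by \<open>g n\<close>, whatever
  the function \<open>u\<close> of the unit ball and whatever the radius.
\<close>

lemma uniformly_radial_L1_limit:
  assumes f: "integrable lborel f" and g: "\<And>n. integrable lborel (g n)" "\<And>n. uniformly_radial (g n)"
    and lim: "\<And>t. (\<lambda>n. g n t) \<longlonglongrightarrow> f t"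
    and bound: "\<And>n t. cmod (g n t) \<le> w t" and w: "integrable lborel w"
  shows "uniformly_radial f"
  unfolding uniformly_radial_def
proof (intro allI impI)
  fix e :: real assume "e > 0"
  have "(\<lambda>n. LINT t|lborel. cmod (f t - g n t)) \<longlonglongrightarrow> (LINT t::real|lborel. (0::real))"
  proof (rule integral_dominated_convergence)
    show "integrable lborel (\<lambda>t. cmod (f t) + w t)" using f w by simp
    show "AE t in lborel. (\<lambda>n. cmod (f t - g n t)) \<longlonglongrightarrow> 0"
    proof (rule AE_I2)
      fix t
      have "(\<lambda>n. cmod (f t - g n t)) \<longlonglongrightarrow> cmod (f t - f t)"
        by (intro tendsto_intros lim)
      then show "(\<lambda>n. cmod (f t - g n t)) \<longlonglongrightarrow> 0" by simp
    qed
    show "AE t in lborel. norm (cmod (f t - g n t)) \<le> cmod (f t) + w t" for n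
      using bound by (auto intro!: norm_triangle_ineq4[THEN order_trans])
  qed (use f g in auto)
  then have "eventually (\<lambda>n. (LINT t|lborel. cmod (f t - g n t)) < e/3) sequentially"
    using \<open>e > 0\<close> by (intro order_tendstoD) auto
  then obtain n where n: "(LINT t|lborel. cmod (f t - g n t)) < e/3"
    by (meson eventually_sequentially order_refl)
  have "e/3 > 0" using \<open>e > 0\<close> by simp
  then obtain r where r: "0 < r" "r < 1" "\<forall>u\<in>Hinf_ball. \<forall>s\<in>{r<..<1}. \<forall>s'\<in>{r<..<1}.
      cmod (radial_integral u s (g n) - radial_integral u s' (g n)) \<le> e/3"
    using g(2)[of n] unfolding uniformly_radial_def by blast
  show "\<exists>r. 0 < r \<and> r < 1 \<and> (\<forall>u\<in>Hinf_ball. \<forall>s\<in>{r<..<1}. \<forall>s'\<in>{r<..<1}.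
      cmod (radial_integral u s f - radial_integral u s' f) \<le> e)"
  proof (intro exI[of _ r] conjI ballI)
    fix u s s' assume *: "u \<in> Hinf_ball" "s \<in> {r<..<1}" "s' \<in> {r<..<1}"
    have d: "cmod (radial_integral u s f - radial_integral u s (g n)) \<le> e/3"
      if "s \<in> {r<..<1}" for s
      using norm_radial_integral_le[of u s "\<lambda>t. f t - g n t"]
        radial_integral_diff[of u s f "g n"] that * r f g n by simp
    have "cmod (radial_integral u s (g n) - radial_integral u s' (g n)) \<le> e/3"
      using r * by blast
    with d[OF *(2)] d[OF *(3)]
    show "cmod (radial_integral u s f - radial_integral u s' f) \<le> e"
      by norm
  qed (use r in auto)
qed

text \<open>
  The factor \<open>cis t\<close> turns the integral over an arc into a contour integral, with value
  \<open>(F (s cis b) - F s) / (\<i> s)\<close> for a primitive \<open>F\<close> of \<open>u\<close>. Since \<open>\<bar>u\<bar> \<le> 1\<close>, the function \<open>F\<close> is 1-Lipschitz,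
  which is a modulus of continuity independent of \<open>u\<close>.
\<close>

lemma uniformly_radial_arc:
  "uniformly_radial (\<lambda>t. indicator ({0..2 * pi} \<inter> {..a}) t * cis t)"
proof (cases "a < 0")
  case True
  then have "{0..2 * pi} \<inter> {..a} = {}" by auto
  then show ?thesis by (auto simp: uniformly_radial_def radial_integral_def intro!: exI[of _ "1/2"])
next
  case False
  define b where "b = min a (2 * pi)"
  have b: "0 \<le> b" "b \<le> 2 * pi" using False by (auto simp: b_def)
  have ab: "{0..2 * pi} \<inter> {..a} = {0..b}" by (auto simp: b_def)
  define f where "f = (\<lambda>t. indicator {0..b} t * cis t)"
  have f: "integrable lborel f"
  proof -
    have "set_integrable lborel {0..b} cis"
      by (intro borel_integrable_atLeastAtMost' continuous_intros)
    moreover have "f = (\<lambda>t. indicator {0..b} t *\<^sub>R cis t)"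
      by (auto simp: f_def indicator_def)
    ultimately show ?thesis by (simp add: set_integrable_def)
  qed
  have nf: "(LINT t|lborel. cmod (f t)) \<le> 8"
  proof -
    have "(LINT t|lborel. cmod (f t)) = (LINT t|lborel. indicator {0..b} t)"
      by (intro Bochner_Integration.integral_cong) (auto simp: f_def norm_mult indicator_def)
    also have "\<dots> = b" using b by simp
    also have "\<dots> \<le> 8" using b pi_less_4 by linarith
    finally show ?thesis .
  qed
  \<comment> \<open>\<open>\<bar>s - s'\<bar>\<close> enters twice through \<open>F\<close> and 8 times, a bound for the length
      of the circle, through the factor \<open>s\<close>; division by \<open>s > 1/2\<close> doubles the total.\<close>
  have main: "cmod (radial_integral u s f - radial_integral u s' f) \<le> 20 * \<bar>s - s'\<bar>"
    if u: "u \<in> Hinf_ball" and s: "1/2 < s" "s < 1" and s': "1/2 < s'" "s' < 1" for u s s'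
  proof -
    obtain F where F: "\<And>z. z \<in> ball 0 1 \<Longrightarrow> (F has_field_derivative u z) (at z within ball 0 1)"
      using holomorphic_convex_primitive'[of "ball 0 1" u] u by (auto simp: Hinf_ball_def)
    have V: "complex_of_real s * radial_integral u s f = (F (of_real s * cis b) - F (of_real s)) / \<i>"
      if s: "1/2 < s" "s < 1" for s
    proof -
      have zin: "of_real s * cis t \<in> ball (0::complex) 1" for t using s by (simp add: norm_mult)
      have hv: "((\<lambda>t. F (of_real s * cis t)) has_vector_derivative
          (\<i> * (of_real s * (u (of_real s * cis t) * cis t)))) (at t within {0..b})" for t
      proof -
        have 1: "(F has_field_derivative u (of_real s * cis t)) (at (of_real s * cis t))"
          using F[OF zin[of t]] zin[of t] at_within_open[OF zin[of t] open_ball] by simp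
        have 2: "((\<lambda>t. of_real s * cis t) has_vector_derivative of_real s * (\<i> * cis t)) (at t within {0..b})"
          unfolding has_vector_derivative_def
          by (rule derivative_eq_intros refl)+ (auto simp: scaleR_conv_of_real)
        show ?thesis
          using field_vector_diff_chain_within[OF 2 DERIV_subset[OF 1]]
          by (simp add: o_def mult_ac)
      qed
      have "(LBINT t. indicator {0..b} t *\<^sub>R (\<i> * (of_real s * (u (of_real s * cis t) * cis t))))
          = F (of_real s * cis b) - F (of_real s * cis 0)"
      proof (rule integral_FTC_atLeastAtMost[OF b(1)])
        show "continuous_on {0..b} (\<lambda>t. \<i> * (of_real s * (u (of_real s * cis t) * cis t)))"
          using s u continuous_on_subset[OF continuous_on_circle[of u s], of "{0..b}"]
          by (intro continuous_intros) (auto simp: Hinf_ball_def)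
      qed (rule hv)
      moreover have "(LBINT t. indicator {0..b} t *\<^sub>R (\<i> * (of_real s * (u (of_real s * cis t) * cis t))))
         = \<i> * (of_real s * radial_integral u s f)"
        unfolding radial_integral_def set_lebesgue_integral_def f_def
          integral_mult_right_zero[symmetric]
        by (intro Bochner_Integration.integral_cong) (use b in \<open>auto simp: indicator_def\<close>)
      ultimately have "\<i> * (of_real s * radial_integral u s f) = F (of_real s * cis b) - F (of_real s)"
        by simp
      then show ?thesis by (metis complex_i_not_zero nonzero_mult_div_cancel_left)
    qed
    have L: "cmod (F (of_real s * c) - F (of_real s' * c)) \<le> \<bar>s - s'\<bar>" if "cmod c = 1" for c
    proof -
      have "cmod (F (of_real s * c) - F (of_real s' * c)) \<le> 1 * cmod (of_real s * c - of_real s' * c)"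
        using F by (rule field_differentiable_bound[OF convex_ball])
          (use u s s' that in \<open>auto simp: norm_mult intro: Hinf_ball_norm_le\<close>)
      also have "\<dots> = \<bar>s - s'\<bar>"
        using that by (simp add: left_diff_distrib[symmetric] norm_mult flip: of_real_diff)
      finally show ?thesis .
    qed
    have R: "cmod (radial_integral u s' f) \<le> 8"
      using norm_radial_integral_le[OF u _ _ f, of s'] nf s' by auto
    have "complex_of_real s * (radial_integral u s f - radial_integral u s' f)
       = ((F (of_real s * cis b) - F (of_real s' * cis b)) - (F (of_real s * 1) - F (of_real s' * 1))) / \<i>
         - of_real (s - s') * radial_integral u s' f"
      using V[OF s] V[OF s'] by (simp add: field_simps)
    then have "cmod (complex_of_real s * (radial_integral u s f - radial_integral u s' f))
       \<le> cmod ((F (of_real s * cis b) - F (of_real s' * cis b)) - (F (of_real s * 1) - F (of_real s' * 1)))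
         + \<bar>s - s'\<bar> * cmod (radial_integral u s' f)"
      using norm_triangle_ineq4 by (metis norm_divide norm_ii div_by_1 norm_mult norm_of_real)
    also have "\<dots> \<le> (\<bar>s - s'\<bar> + \<bar>s - s'\<bar>) + \<bar>s - s'\<bar> * 8"
      using L[of "cis b"] L[of 1]
      by (intro add_mono[OF order_trans[OF norm_triangle_ineq4 add_mono] mult_left_mono[OF R]]) auto
    finally have "s * cmod (radial_integral u s f - radial_integral u s' f) \<le> 10 * \<bar>s - s'\<bar>"
      using s by (simp add: norm_mult)
    moreover have "(1/2) * cmod (radial_integral u s f - radial_integral u s' f)
        \<le> s * cmod (radial_integral u s f - radial_integral u s' f)"
      using s by (intro mult_right_mono) auto
    ultimately show ?thesis by linarith
  qed
  have "uniformly_radial f"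
    unfolding uniformly_radial_def
  proof (intro allI impI)
    fix e :: real assume "e > 0"
    show "\<exists>r. 0 < r \<and> r < 1 \<and> (\<forall>u\<in>Hinf_ball. \<forall>s\<in>{r<..<1}. \<forall>s'\<in>{r<..<1}.
      cmod (radial_integral u s f - radial_integral u s' f) \<le> e)"
    proof (intro exI[of _ "max (1/2) (1 - e/20)"] conjI ballI)
      fix u s s' assume *: "u \<in> Hinf_ball" "s \<in> {max (1/2) (1 - e/20)<..<1}" "s' \<in> {max (1/2) (1 - e/20)<..<1}"
      have "1 - e/20 < s" "s < 1" "1 - e/20 < s'" "s' < 1" using * by auto
      then have "20 * (s - s') \<le> e" "20 * (s' - s) \<le> e" by auto
      then have "20 * \<bar>s - s'\<bar> \<le> e" by (simp add: abs_if)
      with main[of u s s'] * show "cmod (radial_integral u s f - radial_integral u s' f) \<le> e" by auto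
    qed (use \<open>e > 0\<close> in auto)
  qed
  then show ?thesis unfolding ab f_def .
qed

lemma integrable_indicator_cis:
  assumes "A \<in> sets borel"
  shows "integrable lborel (\<lambda>t. indicator ({0..2 * pi} \<inter> A) t * cis t)"
proof (rule Bochner_Integration.integrable_bound)
  show "integrable lborel (indicat_real {0..2 * pi})" by simp
  have "cis \<in> borel_measurable borel" by (intro borel_measurable_continuous_onI continuous_intros)
  then show "(\<lambda>t. indicator ({0..2 * pi} \<inter> A) t * cis t) \<in> borel_measurable lborel"
    using assms by measurable
qed (auto simp: indicator_def norm_mult)

text \<open>
  The rays \<open>{..a}\<close>, which cut out initial arcs of the circle, form an intersection-stable generator of
  the Borel sets, so it suffices that the sets with this property form a Dynkin system.
\<close>

lemma uniformly_radial_indicator: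
  assumes "A \<in> sets borel"
  shows "uniformly_radial (\<lambda>t. indicator ({0..2 * pi} \<inter> A) t * cis t)"
proof -
  have A: "A \<in> sigma_sets UNIV (range (\<lambda>a::real. {..a}))"
    using assms by (simp add: borel_eq_atMost)
  have st: "Int_stable (range (\<lambda>a::real. {..a}))"
    by (auto simp: Int_stable_def)
  have sub: "range (\<lambda>a::real. {..a}) \<subseteq> Pow UNIV" by simp
  have S: "B \<in> sets borel" if "B \<in> sigma_sets UNIV (range (\<lambda>a::real. {..a}))" for B
    using that by (simp add: borel_eq_atMost)
  show ?thesis
    using st sub A
  proof (induct rule: sigma_sets_induct_disjoint)
    case (basic A)
    then show ?case using uniformly_radial_arc by auto
  next
    case empty
    then show ?case by (auto simp: uniformly_radial_def radial_integral_def intro!: exI[of _ "1/2"])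
  next
    case (compl A)
    have "{0..2 * pi} \<inter> {..2 * pi} = {0..2 * pi}" by auto
    with uniformly_radial_arc[of "2 * pi"]
    have whole: "uniformly_radial (\<lambda>t. indicator ({0..2 * pi} \<inter> UNIV) t * cis t)" by simp
    have "A \<in> sets borel" using compl(1) by (rule S)
    then have int: "integrable lborel (\<lambda>t. indicator ({0..2 * pi} \<inter> A) t * cis t)"
      "integrable lborel (\<lambda>t. indicator ({0..2 * pi} \<inter> UNIV) t * cis t)"
      using integrable_indicator_cis[of A] integrable_indicator_cis[of UNIV] by simp_all
    have "uniformly_radial (\<lambda>t. indicator ({0..2 * pi} \<inter> UNIV) t * cis t
        + (-1) * (indicator ({0..2 * pi} \<inter> A) t * cis t))"
      by (rule uniformly_radial_add[OF int(2) integrable_mult_right[OF int(1)] whole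
            uniformly_radial_scale[OF compl(2)]])
    moreover have "(\<lambda>t. indicator ({0..2 * pi} \<inter> UNIV) t * cis t
        + (-1) * (indicator ({0..2 * pi} \<inter> A) t * cis t)) =
        (\<lambda>t. indicator ({0..2 * pi} \<inter> (UNIV - A)) t * cis t)"
      by (auto simp: indicator_def)
    ultimately show ?case by simp
  next
    case (union B)
    have B: "B i \<in> sets borel" for i using union by (auto intro: S)
    have fin: "uniformly_radial (\<lambda>t. indicator ({0..2 * pi} \<inter> (\<Union>i<n. B i)) t * cis t)" for n
    proof (induction n)
      case 0
      then show ?case by (auto simp: uniformly_radial_def radial_integral_def intro!: exI[of _ "1/2"])
    next
      case (Suc n)
      have "B n \<inter> B i = {}" if "i < n" for i
        using union(1) that by (intro disjoint_family_onD[of B UNIV]) auto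
      then have "B n \<inter> (\<Union>i<n. B i) = {}" by blast
      then have "(\<lambda>t. indicator ({0..2 * pi} \<inter> (\<Union>i<Suc n. B i)) t * cis t)
        = (\<lambda>t. indicator ({0..2 * pi} \<inter> (\<Union>i<n. B i)) t * cis t + indicator ({0..2 * pi} \<inter> B n) t * cis t)"
        by (auto simp: indicator_def fun_eq_iff lessThan_Suc)
      then show ?case
        using uniformly_radial_add[OF integrable_indicator_cis integrable_indicator_cis Suc union(3)] B
        by simp
    qed
    show ?case
    proof (rule uniformly_radial_L1_limit[OF _ _ fin])
      show "integrable lborel (\<lambda>t. indicator ({0..2 * pi} \<inter> (\<Union>i. B i)) t * cis t)"
        "integrable lborel (\<lambda>t. indicator ({0..2 * pi} \<inter> (\<Union>i<n. B i)) t * cis t)" for n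
        using B by (intro integrable_indicator_cis; auto)+
      show "integrable lborel (indicat_real {0..2 * pi})" by simp
      show "(\<lambda>n. indicator ({0..2 * pi} \<inter> (\<Union>i<n. B i)) t * cis t)
          \<longlonglongrightarrow> indicator ({0..2 * pi} \<inter> (\<Union>i. B i)) t * cis t" for t
      proof (cases "t \<in> (\<Union>i. B i)")
        case True
        then obtain k where "t \<in> B k" by auto
        then have "\<forall>n\<ge>Suc k. t \<in> (\<Union>i<n. B i)" by auto
        then have "eventually (\<lambda>n. indicator ({0..2 * pi} \<inter> (\<Union>i<n. B i)) t * cis t
            = indicator ({0..2 * pi} \<inter> (\<Union>i. B i)) t * cis t) sequentially"
          unfolding eventually_sequentially using True by (intro exI[of _ "Suc k"]) (simp add: indicator_def)
        then show ?thesis by (rule tendsto_eventually)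
      next
        case False
        then show ?thesis by (auto simp: indicator_def)
      qed
    qed (auto simp: indicator_def norm_mult)
  qed
qed

lemma uniformly_radial_cis_mult:
  assumes "integrable lborel g"
  shows "uniformly_radial (\<lambda>t. cis t * g t)"
proof -
  have cis: "cis \<in> borel_measurable borel" by (intro borel_measurable_continuous_onI continuous_intros)
  have int: "integrable lborel (\<lambda>t. cis t * g t)" if "integrable lborel g" for g
    by (rule Bochner_Integration.integrable_bound[OF that])
      (use borel_measurable_integrable[OF that] cis in \<open>auto simp: norm_mult\<close>)
  show ?thesis
    using assms
  proof (induct rule: integrable_induct)
    case (base A c)
    have "radial_integral u s (\<lambda>t. c * (indicator ({0..2 * pi} \<inter> A) t * cis t))
        = radial_integral u s (\<lambda>t. cis t * (indicator A t *\<^sub>R c))" for u s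
      unfolding radial_integral_def set_lebesgue_integral_def
      by (intro Bochner_Integration.integral_cong) (auto simp: indicator_def)
    with uniformly_radial_scale[OF uniformly_radial_indicator[of A], of c] base show ?case
      by (simp add: uniformly_radial_def)
  next
    case (add f g)
    then show ?case using uniformly_radial_add[OF int[of f] int[of g]] by (simp add: distrib_left)
  next
    case (lim f s)
    show ?case
    proof (rule uniformly_radial_L1_limit[OF int[of f] int[of "s _"]])
      show "cmod (cis t * s n t) \<le> 2 * cmod (f t)" for n t using lim(4) by (simp add: norm_mult)
      show "integrable lborel (\<lambda>t. 2 * cmod (f t))" using lim by simp
      show "(\<lambda>n. cis t * s n t) \<longlonglongrightarrow> cis t * f t" for t using lim by (intro tendsto_intros) auto
    qed (use lim in auto)
  qed
qed

text \<open>
  Multiplication by \<open>cis t\<close> is an isometry of \<open>L\<^sup>1\<close>, so its presence in the arc integrals costs nothing.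
\<close>

lemma uniformly_radial_circle_L1:
  assumes "f \<in> circle_L1"
  shows "uniformly_radial f"
proof -
  define g where "g t = cis (- t) * (indicator {0..2 * pi} t *\<^sub>R f t)" for t
  have "(\<lambda>t. cis (- t)) \<in> borel_measurable borel"
    by (intro borel_measurable_continuous_onI continuous_intros)
  moreover have f: "integrable lborel (\<lambda>t. indicator {0..2 * pi} t *\<^sub>R f t)"
    using assms by (simp add: circle_L1_def set_integrable_def)
  ultimately have "integrable lborel g"
    unfolding g_def
    by (intro Bochner_Integration.integrable_bound[OF f] borel_measurable_times borel_measurable_integrable[OF f])
      (auto simp: norm_mult)
  from uniformly_radial_cis_mult[OF this]
  have "uniformly_radial (\<lambda>t. indicator {0..2 * pi} t *\<^sub>R f t)"
    by (simp add: g_def cis_mult mult.assoc[symmetric])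
  moreover have "radial_integral u s (\<lambda>t. indicator {0..2 * pi} t *\<^sub>R f t) = radial_integral u s f" for u s
    unfolding radial_integral_def set_lebesgue_integral_def
    by (intro Bochner_Integration.integral_cong) (auto simp: indicator_def)
  ultimately show ?thesis by (simp add: uniformly_radial_def)
qed

section \<open>Weak* convergence of bounded sequences\<close>

lemma Hinf_pairing_approx:
  assumes f: "f \<in> circle_L1" and "e > 0"
  shows "\<exists>s. 0 < s \<and> s < 1 \<and>
    (\<forall>u\<in>Hinf_ball. cmod (Hinf_pairing u f - radial_integral u s f / complex_of_real (2 * pi)) \<le> e)"
proof -
  have lim: "\<exists>L. ((\<lambda>s. radial_integral u s f) \<longlongrightarrow> L) (at_left 1)" if u: "u \<in> Hinf_ball" for u
  proof -
    have "\<exists>P. eventually P (at_left 1) \<and>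
        (\<forall>s s'. P s \<and> P s' \<longrightarrow> dist (radial_integral u s f) (radial_integral u s' f) < d)" if "d > 0" for d
    proof -
      obtain r where r: "0 < r" "r < 1" "\<forall>u\<in>Hinf_ball. \<forall>s\<in>{r<..<1}. \<forall>s'\<in>{r<..<1}.
          cmod (radial_integral u s f - radial_integral u s' f) \<le> d/2"
        using uniformly_radial_circle_L1[OF f] \<open>d > 0\<close> unfolding uniformly_radial_def
        by (metis half_gt_zero)
      have "eventually (\<lambda>s. s \<in> {r<..<1}) (at_left (1::real))"
        using r(2) by (rule eventually_at_left_real)
      moreover have "dist (radial_integral u s f) (radial_integral u s' f) < d"
        if "s \<in> {r<..<1}" "s' \<in> {r<..<1}" for s s'
        using r(3) u that \<open>d > 0\<close> by (fastforce simp: dist_norm)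
      ultimately show ?thesis by blast
    qed
    then have "cauchy_filter (filtermap (\<lambda>s. radial_integral u s f) (at_left (1::real)))"
      by (simp add: cauchy_filter_metric_filtermap)
    then have "\<exists>L. filtermap (\<lambda>s. radial_integral u s f) (at_left (1::real)) \<le> nhds L"
      using complete_uniform[of "UNIV :: complex set"] complete_UNIV
      by (force simp: filtermap_bot_iff trivial_limit_at_left_real)
    then show ?thesis by (simp add: filterlim_def)
  qed
  have "2 * pi * e > 0" using \<open>e > 0\<close> by simp
  then obtain r where r: "0 < r" "r < 1" "\<forall>u\<in>Hinf_ball. \<forall>s\<in>{r<..<1}. \<forall>s'\<in>{r<..<1}.
      cmod (radial_integral u s f - radial_integral u s' f) \<le> 2 * pi * e"
    using uniformly_radial_circle_L1[OF f] unfolding uniformly_radial_def by blast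
  define s where "s = (r + 1) / 2"
  have s: "s \<in> {r<..<1}" using r by (auto simp: s_def)
  show ?thesis
  proof (intro exI[of _ s] conjI ballI)
    fix u assume u: "u \<in> Hinf_ball"
    obtain L where L: "((\<lambda>s. radial_integral u s f) \<longlongrightarrow> L) (at_left 1)"
      using lim[OF u] by blast
    then have "Hinf_pairing u f = L / complex_of_real (2 * pi)"
      unfolding Hinf_pairing_def radial_integral_def
      by (intro tendsto_Lim tendsto_intros) auto
    moreover have "cmod (L - radial_integral u s f) \<le> 2 * pi * e"
    proof (rule tendsto_upperbound)
      show "((\<lambda>s'. cmod (radial_integral u s' f - radial_integral u s f))
          \<longlongrightarrow> cmod (L - radial_integral u s f)) (at_left 1)"
        by (intro tendsto_intros L)
      show "eventually (\<lambda>s'. cmod (radial_integral u s' f - radial_integral u s f) \<le> 2 * pi * e) (at_left 1)"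
        using eventually_at_left_real[OF r(2)] by eventually_elim (use r(3) u s in blast)
    qed simp
    ultimately show "cmod (Hinf_pairing u f - radial_integral u s f / complex_of_real (2 * pi)) \<le> e"
      by (simp add: norm_divide norm_mult divide_le_eq mult_ac flip: diff_divide_distrib)
  qed (use s r in auto)
qed

text \<open>
  The error made by replacing the pairing by the integral over a circle of radius \<open>s < 1\<close> has one
  bound for all functions of the sequence; on that circle the integrands converge and are dominated by \<open>\<bar>f\<bar>\<close>.
\<close>

lemma Hinf_pairing_tendsto:
  assumes \<psi>: "\<And>n. \<psi> n \<in> Hinf_ball" and g: "g \<in> Hinf_ball"
    and lim: "\<And>z. z \<in> ball 0 1 \<Longrightarrow> (\<lambda>n. \<psi> n z) \<longlonglongrightarrow> g z" and f: "f \<in> circle_L1"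
  shows "(\<lambda>n. Hinf_pairing (\<psi> n) f) \<longlonglongrightarrow> Hinf_pairing g f"
proof (rule metric_LIMSEQ_I)
  fix e :: real assume "e > 0"
  then have "e/4 > 0" by simp
  obtain s where s: "0 < s" "s < 1" and approx: "\<And>u. u \<in> Hinf_ball \<Longrightarrow>
      cmod (Hinf_pairing u f - radial_integral u s f / complex_of_real (2 * pi)) \<le> e/4"
    using Hinf_pairing_approx[OF f \<open>e/4 > 0\<close>] by blast
  define F where "F t = indicator {0..2 * pi} t *\<^sub>R f t" for t
  have F: "integrable lborel F"
    using f by (simp add: F_def[abs_def] circle_L1_def set_integrable_def)
  have eq: "radial_integral u s f = radial_integral u s F" for u
    unfolding radial_integral_def set_lebesgue_integral_def
    by (intro Bochner_Integration.integral_cong) (auto simp: indicator_def F_def)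
  have zin: "complex_of_real s * cis t \<in> ball 0 1" for t using s by (simp add: norm_mult)
  have "(\<lambda>n. radial_integral (\<psi> n) s F) \<longlonglongrightarrow> radial_integral g s F"
    unfolding radial_integral_def set_lebesgue_integral_def
  proof (rule integral_dominated_convergence)
    show "integrable lborel (\<lambda>t. cmod (F t))" using F by simp
    show "AE t in lborel. (\<lambda>n. indicat_real {0..2 * pi} t *\<^sub>R (\<psi> n (complex_of_real s * cis t) * F t))
        \<longlonglongrightarrow> indicat_real {0..2 * pi} t *\<^sub>R (g (complex_of_real s * cis t) * F t)"
      by (intro AE_I2 tendsto_intros lim zin)
    show "AE t in lborel. norm (indicat_real {0..2 * pi} t *\<^sub>R (\<psi> n (complex_of_real s * cis t) * F t))
        \<le> cmod (F t)" for n
      using Hinf_ball_norm_le[OF \<psi>[of n]] zin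
      by (auto simp: norm_mult indicator_def mult_left_le_one_le)
  qed (use radial_integrable[OF _ s F] \<psi> g in auto)
  then have "(\<lambda>n. radial_integral (\<psi> n) s f / complex_of_real (2 * pi))
      \<longlonglongrightarrow> radial_integral g s f / complex_of_real (2 * pi)"
    unfolding eq by (intro tendsto_intros) auto
  from metric_LIMSEQ_D[OF this \<open>e/4 > 0\<close>]
  obtain N where N: "\<And>n. n \<ge> N \<Longrightarrow> cmod (radial_integral (\<psi> n) s f / complex_of_real (2 * pi)
      - radial_integral g s f / complex_of_real (2 * pi)) < e/4"
    by (auto simp: dist_norm)
  show "\<exists>N. \<forall>n\<ge>N. dist (Hinf_pairing (\<psi> n) f) (Hinf_pairing g f) < e"
  proof (intro exI[of _ N] allI impI)
    fix n assume "n \<ge> N"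
    have "cmod (a - d) < e" if "cmod (b - c) < e/4" "cmod (a - b) \<le> e/4" "cmod (d - c) \<le> e/4" for a b c d
      using that \<open>e > 0\<close> by norm
    from this[OF N[OF \<open>n \<ge> N\<close>] approx[OF \<psi>] approx[OF g]]
    show "dist (Hinf_pairing (\<psi> n) f) (Hinf_pairing g f) < e" unfolding dist_norm .
  qed
qed

lemma limitin_weak_star_Hinf:
  assumes \<psi>: "\<And>n. \<psi> n \<in> Hinf_ball" and g: "g \<in> Hinf_ball"
    and lim: "\<And>z. z \<in> ball 0 1 \<Longrightarrow> (\<lambda>n. \<psi> n z) \<longlonglongrightarrow> g z"
  shows "limitin weak_star_Hinf \<psi> g sequentially"
proof -
  let ?E = "\<lambda>u. \<lambda>f\<in>circle_L1. Hinf_pairing u f"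
  have "limitin (product_topology (\<lambda>_. euclidean) circle_L1) (\<lambda>n. ?E (\<psi> n)) (?E g) sequentially"
    unfolding limitin_componentwise
    using Hinf_pairing_tendsto[OF assms] by simp
  then show ?thesis
    using \<psi> g Hinf_ball_Hinf unfolding limitin_def weak_star_Hinf_def
    by (force simp: topspace_pullback_topology openin_pullback_topology)
qed

lemma topspace_weak_star_Hinf: "topspace weak_star_Hinf = Hinf"
  by (auto simp: weak_star_Hinf_def topspace_pullback_topology)

lemma topspace_weak_star_operators: "topspace weak_star_operators = bounded_operators"
  by (auto simp: weak_star_operators_def topspace_pullback_topology)

section \<open>Hilbert space preliminaries\<close>

lemma cinner_zero_left [simp]: "cinner 0 y = 0"
  using cinner_add_left[of 0 0 y] by simp

lemma cinner_zero_right [simp]: "cinner x 0 = 0"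
  using cinner_commute[of x 0] by simp

text \<open>
  A matrix coefficient is the pairing with a trace class operator of rank one.
\<close>

lemma continuous_map_matrix_coefficient:
  "continuous_map weak_star_operators euclidean (\<lambda>S. cinner (blinfun_apply S x) y)"
proof -
  define p where "p = (\<lambda>n::nat. if n = 0 then x else 0, \<lambda>n::nat. if n = 0 then y else 0)"
  have "summable (\<lambda>n::nat. (norm (if n = 0 then z else 0))\<^sup>2)" for z :: 'a
    by (rule summable_finite[of "{0}"]) auto
  then have p: "p \<in> square_summable \<times> square_summable"
    by (simp add: p_def square_summable_def)
  have "trace_pairing S p = cinner (blinfun_apply S x) y" for S
    unfolding p_def trace_pairing_def prod.case by (subst suminf_finite[of "{0}"]) auto
  moreover have "continuous_map weak_star_operators euclidean
      ((\<lambda>F. F p) \<circ> (\<lambda>T. \<lambda>p\<in>square_summable \<times> square_summable. trace_pairing T p))"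
    unfolding weak_star_operators_def
    by (intro continuous_map_pullback continuous_map_product_projection p)
  ultimately show ?thesis using p by (simp add: o_def)
qed

text \<open>
  Both parts of the complex inner product are real inner products of \<open>x\<close> with a fixed vector, which
  gives continuity in the first argument.
\<close>

lemma cinner_eq_inner: "cinner x y = Complex (inner x y) (inner (\<i> *\<^sub>C y) x)"
proof -
  have "Re (cinner (\<i> *\<^sub>C y) x) = inner (\<i> *\<^sub>C y) x" by (rule Re_cinner)
  then have "Im (cinner x y) = inner (\<i> *\<^sub>C y) x"
    by (subst cinner_commute) (simp add: cinner_scaleC_left)
  then show ?thesis by (simp add: complex_eq_iff Re_cinner)
qed

lemma cinner_self_eq_0_iff: "cinner x x = 0 \<longleftrightarrow> x = 0"
proof
  assume "cinner x x = 0"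
  then have "inner x x = 0" using Re_cinner[of x x] by simp
  then show "x = 0" by simp
qed simp

lemma closed_csubspace_cinner_eq_0: "closed_csubspace {x. cinner x h = 0}"
proof -
  have "{x. cinner x h = 0} = {x. inner x h = 0} \<inter> {x. inner (\<i> *\<^sub>C h) x = 0}"
    by (auto simp: cinner_eq_inner complex_eq_iff)
  moreover have "closed {x. inner x h = 0}" "closed {x. inner (\<i> *\<^sub>C h) x = 0}"
    by (intro closed_Collect_eq continuous_intros)+
  ultimately have "closed {x. cinner x h = 0}" by (simp add: closed_Int)
  then show ?thesis
    by (auto simp: closed_csubspace_def complex_vector.subspace_def
        cinner_add_left cinner_scaleC_left)
qed

text \<open>
  Every closed subspace is invariant under a scalar operator; the orthogonal complement of a non-zero
  vector is a proper one, and it is non-zero because the space is not one-dimensional.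
\<close>

lemma scalar_operator_has_invariant_subspace:
  fixes T :: "'a::complex_hilbert_space \<Rightarrow>\<^sub>L 'a"
  assumes inf: "infinite_dimensional TYPE('a)" and T: "\<And>x. blinfun_apply T x = c *\<^sub>C x"
    and "(h::'a) \<noteq> 0"
  shows "\<exists>M. nontrivial_invariant_subspace T M"
proof -
  let ?M = "{x. cinner x h = 0}"
  have hh: "cinner h h \<noteq> 0" using \<open>h \<noteq> 0\<close> by (simp add: cinner_self_eq_0_iff)
  obtain x where x: "x \<notin> cspan {h}"
    using inf unfolding infinite_dimensional_def by blast
  define k where "k = cinner x h / cinner h h"
  define y where "y = x + (- k) *\<^sub>C h"
  have "y \<noteq> 0"
  proof
    assume "y = 0"
    then have "x = k *\<^sub>C h"
      by (simp add: y_def complex_vector.scale_minus_left)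
    then show False
      using x complex_vector.span_scale[OF complex_vector.span_base, of h "{h}" k]
      by simp
  qed
  moreover have "cinner y h = 0"
    unfolding y_def k_def cinner_add_left cinner_scaleC_left using hh by simp
  ultimately have "?M \<noteq> {0}" by auto
  moreover have "?M \<noteq> UNIV" using hh by auto
  moreover have "invariant_subspace T ?M"
    using closed_csubspace_cinner_eq_0
    by (auto simp: invariant_subspace_def T cinner_scaleC_left)
  ultimately show ?thesis unfolding nontrivial_invariant_subspace_def by blast
qed

section \<open>The functional calculus on an operator without invariant subspaces\<close>

lemma Hinf_const: "(\<lambda>_. c) \<in> Hinf"
  by (auto simp: Hinf_def bounded_iff)

lemma Hinf_ident: "(\<lambda>z. z) \<in> Hinf"
  by (auto simp: Hinf_def bounded_iff intro!: exI[of _ 1])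

lemma Hinf_add:
  assumes "u \<in> Hinf" "v \<in> Hinf" shows "(\<lambda>z. u z + v z) \<in> Hinf"
  using assms by (auto simp: Hinf_def intro: holomorphic_intros bounded_plus_comp)

lemma Hinf_bound:
  assumes "u \<in> Hinf"
  obtains B where "0 < B" "\<And>z. z \<in> ball 0 1 \<Longrightarrow> cmod (u z) \<le> B"
  using assms unfolding Hinf_def bounded_pos by blast

lemma Hinf_mult:
  assumes "u \<in> Hinf" "v \<in> Hinf" shows "(\<lambda>z. u z * v z) \<in> Hinf"
proof -
  obtain A where A: "\<And>z. z \<in> ball 0 1 \<Longrightarrow> cmod (u z) \<le> A"
    using Hinf_bound[OF assms(1)] by metis
  obtain B where B: "\<And>z. z \<in> ball 0 1 \<Longrightarrow> cmod (v z) \<le> B"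
    using Hinf_bound[OF assms(2)] by metis
  have "cmod (u z * v z) \<le> A * B" if "z \<in> ball 0 1" for z
    unfolding norm_mult
    using A[OF that] B[OF that] by (intro mult_mono) (auto intro: order_trans[OF norm_ge_zero])
  then show ?thesis
    using assms unfolding Hinf_def bounded_iff by (blast intro: holomorphic_intros)
qed

locale Hinf_calculus =
  fixes T :: "'a::complex_hilbert_space \<Rightarrow>\<^sub>L 'a"
    and \<Phi> :: "(complex \<Rightarrow> complex) \<Rightarrow> ('a \<Rightarrow>\<^sub>L 'a)"
  assumes functional_calculus: "functional_calculus T \<Phi>"
begin

lemma
  shows add: "u \<in> Hinf \<Longrightarrow> v \<in> Hinf \<Longrightarrow> \<Phi> (\<lambda>z. u z + v z) = \<Phi> u + \<Phi> v"
    and scale: "u \<in> Hinf \<Longrightarrow> blinfun_apply (\<Phi> (\<lambda>z. c * u z)) x = c *\<^sub>C blinfun_apply (\<Phi> u) x"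
    and mult: "u \<in> Hinf \<Longrightarrow> v \<in> Hinf \<Longrightarrow> \<Phi> (\<lambda>z. u z * v z) = \<Phi> u o\<^sub>L \<Phi> v"
    and one: "\<Phi> (\<lambda>_. 1) = id_blinfun"
    and ident: "\<Phi> (\<lambda>z. z) = T"
    and weak_star_continuous: "continuous_map weak_star_Hinf weak_star_operators \<Phi>"
    and norm_bound: "u \<in> Hinf \<Longrightarrow> norm (\<Phi> u) \<le> Hinf_norm u"
  using functional_calculus unfolding functional_calculus_def by blast+

lemma complex_linear:
  assumes "u \<in> Hinf"
  shows "blinfun_apply (\<Phi> u) (c *\<^sub>C x) = c *\<^sub>C blinfun_apply (\<Phi> u) x"
proof -
  have "\<Phi> u \<in> bounded_operators"
    using weak_star_continuous assms
    by (auto simp: continuous_map_def topspace_weak_star_Hinf topspace_weak_star_operators)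
  then show ?thesis by (simp add: bounded_operators_def)
qed

lemma cong:
  assumes "u \<in> Hinf" "v \<in> Hinf" "\<And>z. z \<in> ball 0 1 \<Longrightarrow> u z = v z"
  shows "\<Phi> u = \<Phi> v"
proof -
  have v: "(\<lambda>z. (-1) * v z) \<in> Hinf" by (intro Hinf_mult Hinf_const assms)
  have "Hinf_norm (\<lambda>z. u z + (-1) * v z) = (SUP z\<in>ball (0::complex) 1. 0)"
    unfolding Hinf_norm_def by (intro SUP_cong) (use assms(3) in auto)
  then have "norm (\<Phi> (\<lambda>z. u z + (-1) * v z)) \<le> 0"
    using norm_bound[OF Hinf_add[OF assms(1) v]] by simp
  then have "\<Phi> u + \<Phi> (\<lambda>z. (-1) * v z) = 0"
    using add[OF assms(1) v] by simp
  then have "blinfun_apply (\<Phi> u) x + (-1) *\<^sub>C blinfun_apply (\<Phi> v) x = 0" for x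
    using scale[OF assms(2), of "-1" x] by (metis plus_blinfun.rep_eq zero_blinfun.rep_eq)
  then show ?thesis
    by (intro blinfun_eqI) (simp add: complex_vector.scale_minus_left scaleC_one)
qed

lemma commute:
  assumes "u \<in> Hinf" shows "blinfun_apply T (blinfun_apply (\<Phi> u) x) = blinfun_apply (\<Phi> u) (blinfun_apply T x)"
proof -
  have "T o\<^sub>L \<Phi> u = \<Phi> u o\<^sub>L T"
    using mult[OF Hinf_ident assms] mult[OF assms Hinf_ident] by (simp add: ident mult.commute)
  then show ?thesis by (metis blinfun_apply_blinfun_compose)
qed

text \<open>
  \<open>u(T)\<close> commutes with \<open>T\<close>, and its kernel is a complex subspace because weak* continuity of the calculus
  includes that \<open>u(T)\<close> is complex linear.
\<close>

lemma invariant_subspace_kernel: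
  assumes u: "u \<in> Hinf"
  shows "invariant_subspace T {x. blinfun_apply (\<Phi> u) x = 0}"
proof -
  have "closed {x. blinfun_apply (\<Phi> u) x = 0}"
    by (intro closed_Collect_eq continuous_intros)
  moreover have "csubspace {x. blinfun_apply (\<Phi> u) x = 0}"
    by (auto simp: complex_vector.subspace_def blinfun.add_right
        complex_linear[OF u] complex_vector.scale_zero_right)
  moreover have "blinfun_apply (\<Phi> u) (blinfun_apply T x) = 0" if "blinfun_apply (\<Phi> u) x = 0" for x
    using commute[OF u, of x] that by simp
  ultimately show ?thesis by (auto simp: invariant_subspace_def closed_csubspace_def)
qed

lemma kernel_trivial:
  assumes "\<nexists>M. nontrivial_invariant_subspace T M" "u \<in> Hinf"
    "blinfun_apply (\<Phi> u) x = 0" "x \<noteq> 0"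
  shows "\<Phi> u = 0"
proof -
  have "{x. blinfun_apply (\<Phi> u) x = 0} = UNIV"
    using assms invariant_subspace_kernel[OF assms(2)]
    unfolding nontrivial_invariant_subspace_def by blast
  then show ?thesis by (intro blinfun_eqI) auto
qed

text \<open>
  If \<open>u(T) v(T) = 0\<close> and \<open>v(T) \<noteq> 0\<close>, the range of \<open>v(T)\<close> supplies a non-zero vector in the kernel of \<open>u(T)\<close>.
\<close>

lemma mult_eq_0:
  assumes "\<nexists>M. nontrivial_invariant_subspace T M" "u \<in> Hinf" "v \<in> Hinf"
    "\<Phi> (\<lambda>z. u z * v z) = 0"
  shows "\<Phi> u = 0 \<or> \<Phi> v = 0"
proof (rule ccontr)
  assume *: "\<not> (\<Phi> u = 0 \<or> \<Phi> v = 0)"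
  then obtain x where "blinfun_apply (\<Phi> v) x \<noteq> 0"
    by (metis blinfun_eqI zero_blinfun.rep_eq)
  moreover have "blinfun_apply (\<Phi> u) (blinfun_apply (\<Phi> v) x) = 0"
    using mult[OF assms(2,3)] assms(4) by (metis blinfun_apply_blinfun_compose zero_blinfun.rep_eq)
  ultimately show False using kernel_trivial[OF assms(1,2)] * by blast
qed

text \<open>
  The matrix coefficients of \<open>\<Phi> (\<psi> n)\<close> vanish and converge to those of \<open>\<Phi> g\<close>. So the annihilator of \<open>T\<close>
  is closed under bounded pointwise convergence; this is the only use of weak* continuity besides
  complex linearity.
\<close>

lemma weak_star_limit_zero:
  assumes "\<And>n. \<psi> n \<in> Hinf_ball" "g \<in> Hinf_ball"
    and "\<And>z. z \<in> ball 0 1 \<Longrightarrow> (\<lambda>n. \<psi> n z) \<longlonglongrightarrow> g z"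
    and zero: "\<And>n. \<Phi> (\<psi> n) = 0"
  shows "\<Phi> g = 0"
proof (rule blinfun_eqI)
  fix x
  let ?y = "blinfun_apply (\<Phi> g) x"
  have "limitin weak_star_operators (\<Phi> \<circ> \<psi>) (\<Phi> g) sequentially"
    by (rule continuous_map_limit[OF weak_star_continuous limitin_weak_star_Hinf[OF assms(1-3)]])
  from continuous_map_limit[OF continuous_map_matrix_coefficient[of x ?y] this]
  have "(\<lambda>n. 0) \<longlonglongrightarrow> cinner ?y ?y"
    by (simp add: o_def zero)
  then have "cinner ?y ?y = 0" using LIMSEQ_unique tendsto_const by blast
  then show "?y = blinfun_apply 0 x" by (simp add: cinner_self_eq_0_iff)
qed

end

section \<open>The extremal problem\<close>

text \<open>
  Composing \<open>g\<close> with the disk automorphism that sends 0 to \<open>l\<close> gives a function that vanishes at 0, and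
  Schwarz's lemma for it says that \<open>\<bar>g\<bar>\<close> is at most the modulus of the Blaschke factor at \<open>l\<close>. Besides the
  quotient by the Blaschke factor, the quotient \<open>k\<close> by the linear factor appears, because the
  functional calculus handles \<open>z - l\<close> and \<open>1 - cnj l z\<close> as separate multiplications.
\<close>

lemma divide_Blaschke_factor:
  assumes g: "g \<in> Hinf_ball" and l: "cmod l < 1" "g l = 0"
  obtains k where "k \<in> Hinf" "\<And>z. z \<in> ball 0 1 \<Longrightarrow> g z = (z - l) * k z"
    "(\<lambda>z. (1 - cnj l * z) * k z) \<in> Hinf_ball"
proof -
  define k where "k = (\<lambda>z. if z = l then deriv g l else (g z - g l) / (z - l))"
  define q where "q = (\<lambda>z. (1 - cnj l * z) * k z)"
  have hg: "g holomorphic_on ball 0 1" using g by (simp add: Hinf_ball_def)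
  have k: "k holomorphic_on ball 0 1" unfolding k_def by (rule pole_lemma_open[OF hg open_ball])
  have gk: "g z = (z - l) * k z" for z using l by (simp add: k_def)
  have q: "q holomorphic_on ball 0 1" unfolding q_def by (intro holomorphic_intros k)
  have nz: "1 - cmod l \<le> cmod (1 - cnj l * z)" if "z \<in> ball 0 1" for z
  proof -
    have "cmod (cnj l * z) \<le> cmod l" using that by (simp add: norm_mult mult_left_le)
    then show ?thesis using norm_triangle_ineq2[of 1 "cnj l * z"] by simp
  qed
  have schwarz: "cmod (g z) \<le> cmod (Moebius_function 0 l z)" if z: "z \<in> ball 0 1" for z
  proof (rule field_le_mult_one_interval)
    \<comment> \<open>Schwarz's lemma wants values strictly inside the disk, hence the factor \<open>t < 1\<close>.\<close>
    fix t :: real assume t: "0 < t" "t < 1"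
    define F where "F w = of_real t * g (Moebius_function 0 (- l) w)" for w
    have "F holomorphic_on ball 0 1"
      unfolding F_def
      by (intro holomorphic_intros holomorphic_on_compose_gen[OF Moebius_function_holomorphic hg, unfolded o_def])
        (use l in \<open>auto simp: Moebius_function_norm_lt_1\<close>)
    moreover have "F 0 = 0" using l by (simp add: F_def Moebius_function_of_zero)
    moreover have "cmod (F w) < 1" if "cmod w < 1" for w
    proof -
      have "cmod (F w) \<le> t * 1" unfolding F_def norm_mult norm_of_real
        using t l that by (intro mult_mono Hinf_ball_norm_le[OF g] Moebius_function_norm_lt_1) auto
      then show ?thesis using t by simp
    qed
    moreover have "cmod (Moebius_function 0 l z) < 1"
      using z l by (auto intro: Moebius_function_norm_lt_1)
    ultimately have "cmod (F (Moebius_function 0 l z)) \<le> cmod (Moebius_function 0 l z)"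
      by (rule Schwarz_Lemma(1))
    moreover have "F (Moebius_function 0 l z) = of_real t * g z"
      using z l by (simp add: F_def Moebius_function_compose)
    ultimately show "t * cmod (g z) \<le> cmod (Moebius_function 0 l z)"
      using t by (simp add: norm_mult)
  qed
  have q1: "cmod (q z) \<le> 1" if z: "z \<in> ball 0 1" "z \<noteq> l" for z
  proof -
    have pos: "cmod (1 - cnj l * z) > 0" using nz[OF z(1)] l by linarith
    have "cmod (z - l) * cmod (k z) \<le> cmod (z - l) / cmod (1 - cnj l * z)"
      using schwarz[OF z(1)] by (simp add: gk Moebius_function_def norm_mult norm_divide)
    then have "cmod (z - l) * (cmod (1 - cnj l * z) * cmod (k z)) \<le> cmod (z - l) * 1"
      using pos by (simp add: field_simps)
    then show ?thesis using z by (simp add: q_def norm_mult)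
  qed
  have "cmod (q l) \<le> 1"
  proof (rule tendsto_upperbound)
    have "isCont q l"
      using q l by (intro continuous_on_interior[OF holomorphic_on_imp_continuous_on[OF q]]) auto
    then show "((\<lambda>z. cmod (q z)) \<longlongrightarrow> cmod (q l)) (at l)"
      by (intro tendsto_norm) (simp add: isCont_def)
    have "eventually (\<lambda>z. z \<in> ball 0 1 - {l}) (at l)"
      using l by (intro eventually_at_in_open) auto
    then show "eventually (\<lambda>z. cmod (q z) \<le> 1) (at l)"
      by eventually_elim (use q1 in auto)
  qed simp
  then have q1': "cmod (q z) \<le> 1" if "z \<in> ball 0 1" for z using q1 that by blast
  have "cmod (k z) \<le> 1 / (1 - cmod l)" if z: "z \<in> ball 0 1" for z
  proof -
    have "(1 - cmod l) * cmod (k z) \<le> cmod (1 - cnj l * z) * cmod (k z)"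
      using nz[OF z] by (intro mult_right_mono) auto
    also have "\<dots> \<le> 1" using q1'[OF z] by (simp add: q_def norm_mult)
    finally show ?thesis using l by (simp add: field_simps)
  qed
  then have "k \<in> Hinf" using k unfolding Hinf_def bounded_iff by blast
  moreover have "q \<in> Hinf_ball" using q q1' by (simp add: Hinf_ball_def)
  ultimately show ?thesis using that gk unfolding q_def by blast
qed

lemma Blaschke_factor_lt_1:
  assumes "cmod l < 1" "cmod z < 1"
  shows "cmod (z - l) < cmod (1 - cnj l * z)"
proof -
  have "cmod (cnj l * z) < 1" using assms norm_mult_less[of "cnj l" 1 z 1] by simp
  then have "1 - cnj l * z \<noteq> 0" by (metis eq_iff_diff_eq_0 less_irrefl norm_one)
  then show ?thesis
    using Moebius_function_norm_lt_1[OF assms, of 0]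
    by (simp add: Moebius_function_def norm_divide)
qed

text \<open>
  Montel's theorem provides a pointwise convergent subsequence of any maximising sequence, so closure
  of \<open>A\<close> under bounded pointwise limits is all the compactness that is needed.
\<close>

lemma extremal_function_exists:
  assumes A: "A \<subseteq> Hinf_ball" "A \<noteq> {}" and z0: "z0 \<in> ball 0 1"
    and closed: "\<And>\<psi> g. (\<And>n. \<psi> n \<in> A) \<Longrightarrow> g \<in> Hinf_ball \<Longrightarrow>
       (\<And>z. z \<in> ball 0 1 \<Longrightarrow> (\<lambda>n. \<psi> n z) \<longlonglongrightarrow> g z) \<Longrightarrow> g \<in> A"
  obtains g where "g \<in> A" "\<And>u. u \<in> A \<Longrightarrow> cmod (u z0) \<le> cmod (g z0)"
proof -
  define S where "S = (SUP u\<in>A. cmod (u z0))"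
  have bdd: "bdd_above ((\<lambda>u. cmod (u z0)) ` A)"
    using A z0 by (intro bdd_aboveI[of _ 1]) (auto simp: Hinf_ball_def)
  have "\<exists>u\<in>A. S - 1 / real (Suc n) < cmod (u z0)" for n
    using less_cSUP_iff[OF A(2) bdd, of "S - 1 / real (Suc n)"] by (auto simp: S_def)
  then obtain \<psi> where \<psi>: "\<And>n. \<psi> n \<in> A" "\<And>n. S - 1 / real (Suc n) < cmod (\<psi> n z0)" by metis
  obtain g r where hg: "g holomorphic_on ball 0 1" and r: "strict_mono (r :: nat \<Rightarrow> nat)"
    and lim: "\<And>z. z \<in> ball 0 1 \<Longrightarrow> (\<lambda>n. \<psi> (r n) z) \<longlonglongrightarrow> g z"
  proof (rule Montel[of "ball 0 1" Hinf_ball \<psi>])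
    show "\<exists>B. \<forall>h\<in>Hinf_ball. \<forall>z\<in>K. cmod (h z) \<le> B" if "K \<subseteq> ball 0 1" for K
      using that by (auto simp: Hinf_ball_def intro!: exI[of _ 1])
    show "h holomorphic_on ball 0 1" if "h \<in> Hinf_ball" for h
      using that by (simp add: Hinf_ball_def)
    show "range \<psi> \<subseteq> Hinf_ball" using \<psi> A by auto
  qed (use open_ball that in blast)+
  have "cmod (g z) \<le> 1" if "z \<in> ball 0 1" for z
  proof (rule tendsto_upperbound[OF tendsto_norm[OF lim[OF that]]])
    show "eventually (\<lambda>n. cmod (\<psi> (r n) z) \<le> 1) sequentially"
      using \<psi>(1) A(1) that by (intro always_eventually allI Hinf_ball_norm_le) auto
  qed simp
  then have g: "g \<in> A"
    using closed[of "\<lambda>n. \<psi> (r n)" g] \<psi> lim hg by (simp add: Hinf_ball_def)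
  have "S \<le> cmod (g z0)"
  proof (rule LIMSEQ_le)
    show "(\<lambda>n. cmod (\<psi> (r n) z0)) \<longlonglongrightarrow> cmod (g z0)" by (intro tendsto_norm lim z0)
    have "(\<lambda>n. S - 1 / real (Suc n)) \<longlonglongrightarrow> S - 0"
      by (intro tendsto_diff tendsto_const LIMSEQ_Suc lim_1_over_n)
    then show "(\<lambda>n. S - 1 / real (Suc n)) \<longlonglongrightarrow> S" by simp
    have "S - 1 / real (Suc n) \<le> cmod (\<psi> (r n) z0)" for n
    proof -
      have "1 / real (Suc (r n)) \<le> 1 / real (Suc n)"
        using seq_suble[OF r, of n] by (intro divide_left_mono) auto
      with \<psi>(2)[of "r n"] show ?thesis by linarith
    qed
    then show "\<exists>N. \<forall>n\<ge>N. S - 1 / real (Suc n) \<le> cmod (\<psi> (r n) z0)" by blast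
  qed
  then have "cmod (u z0) \<le> cmod (g z0)" if "u \<in> A" for u
    using cSUP_upper[OF that bdd] by (simp add: S_def)
  with g that show ?thesis by blast
qed

section \<open>Existence of an invariant subspace\<close>

theorem theorem2p3:
  fixes T :: "'a::complex_hilbert_space \<Rightarrow>\<^sub>L 'a"
    and \<Phi> :: "(complex \<Rightarrow> complex) \<Rightarrow> ('a \<Rightarrow>\<^sub>L 'a)"
  assumes "separable_space (euclidean :: 'a topology)"
    and "infinite_dimensional TYPE('a)"
    and "contraction T"
    and "completely_nonunitary T"
    and "functional_calculus T \<Phi>"
    and "\<exists>h. nontrivial_algebraic_element \<Phi> h"
  shows "\<exists>M. nontrivial_invariant_subspace T M"
proof (rule ccontr)
  assume no: "\<nexists>M. nontrivial_invariant_subspace T M"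
  interpret Hinf_calculus T \<Phi> using assms(5) by unfold_locales
  obtain h \<theta> where h: "h \<noteq> 0" "blinfun_apply (\<Phi> \<theta>) h = 0" and \<theta>: "\<theta> \<in> Hinf" "Hinf_nonzero \<theta>"
    using assms(6) by (auto simp: nontrivial_algebraic_element_def algebraic_element_def)
  obtain z0 where z0: "z0 \<in> ball 0 1" "\<theta> z0 \<noteq> 0" using \<theta>(2) by (auto simp: Hinf_nonzero_def)
  have \<Phi>\<theta>: "\<Phi> \<theta> = 0" using kernel_trivial[OF no \<theta>(1) h(2,1)] .
  have lin: "(\<lambda>z. z + - l) \<in> Hinf" for l by (intro Hinf_add Hinf_ident Hinf_const)
  have nonscalar: "\<Phi> (\<lambda>z. z + - l) \<noteq> 0" for l
  proof
    assume "\<Phi> (\<lambda>z. z + - l) = 0"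
    moreover have "blinfun_apply (\<Phi> (\<lambda>z. - l)) x = (- l) *\<^sub>C x" for x
      using scale[OF Hinf_const[of 1], of "- l" x] by (simp add: one)
    ultimately have "blinfun_apply T x + (- l) *\<^sub>C x = 0" for x
      using add[OF Hinf_ident Hinf_const[of "- l"]]
      by (metis ident plus_blinfun.rep_eq zero_blinfun.rep_eq)
    then have "blinfun_apply T x = l *\<^sub>C x" for x
      by (simp add: complex_vector.scale_minus_left)
    then show False using scalar_operator_has_invariant_subspace[OF assms(2) _ h(1)] no by blast
  qed
  define A where "A = {u \<in> Hinf_ball. \<Phi> u = 0}"
  obtain B where "B > 0" and B: "\<And>z. z \<in> ball 0 1 \<Longrightarrow> cmod (\<theta> z) \<le> B"
    using Hinf_bound[OF \<theta>(1)] by metis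
  define \<theta>1 where "\<theta>1 = (\<lambda>z. complex_of_real (1/B) * \<theta> z)"
  have "\<theta>1 \<in> A"
  proof -
    have "\<theta>1 \<in> Hinf_ball"
      using \<theta>(1) B \<open>B > 0\<close>
      by (auto simp: \<theta>1_def Hinf_ball_def Hinf_def norm_mult norm_divide divide_simps
          intro!: holomorphic_intros)
    moreover have "\<Phi> \<theta>1 = 0"
      unfolding \<theta>1_def
      by (intro blinfun_eqI, subst scale[OF \<theta>(1)]) (simp add: \<Phi>\<theta>)
    ultimately show ?thesis by (simp add: A_def)
  qed
  obtain g where gA: "g \<in> A" and gmax: "\<And>u. u \<in> A \<Longrightarrow> cmod (u z0) \<le> cmod (g z0)"
  proof (rule extremal_function_exists[of A z0])
    show "g \<in> A" if "\<And>n. \<psi> n \<in> A" "g \<in> Hinf_ball"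
      "\<And>z. z \<in> ball 0 1 \<Longrightarrow> (\<lambda>n. \<psi> n z) \<longlonglongrightarrow> g z" for \<psi> g
      using that weak_star_limit_zero[of \<psi> g] by (auto simp: A_def)
  qed (use \<open>\<theta>1 \<in> A\<close> z0 that in \<open>auto simp: A_def\<close>)
  have g: "g \<in> Hinf_ball" "\<Phi> g = 0" using gA by (auto simp: A_def)
  have "\<theta>1 z0 \<noteq> 0" using z0 \<open>B > 0\<close> by (simp add: \<theta>1_def)
  then have gz0: "cmod (g z0) > 0" using gmax[OF \<open>\<theta>1 \<in> A\<close>] by (smt (verit) zero_less_norm_iff)
  \<comment> \<open>Dividing out a zero would produce a better competitor at \<open>z0\<close>.\<close>
  have nozero: "g l \<noteq> 0" if l: "l \<in> ball 0 1" for l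
  proof
    assume gl: "g l = 0"
    obtain k where k: "k \<in> Hinf" "\<And>z. z \<in> ball 0 1 \<Longrightarrow> g z = (z - l) * k z"
      "(\<lambda>z. (1 - cnj l * z) * k z) \<in> Hinf_ball"
      using divide_Blaschke_factor[OF g(1) _ gl] l by auto
    have "\<Phi> (\<lambda>z. (z + - l) * k z) = 0"
      using cong[OF Hinf_mult[OF lin k(1)] Hinf_ball_Hinf[OF g(1)]] k(2) g(2) by simp
    then have "\<Phi> k = 0" using mult_eq_0[OF no lin k(1)] nonscalar by blast
    moreover have "(\<lambda>z. 1 + (- cnj l) * z) \<in> Hinf"
      by (intro Hinf_add Hinf_mult Hinf_ident Hinf_const)
    ultimately have "\<Phi> (\<lambda>z. (1 - cnj l * z) * k z) = 0"
      using mult[of "\<lambda>z. 1 + (- cnj l) * z" k] k(1)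
      by (simp add: bounded_bilinear.zero_right[OF bounded_bilinear_blinfun_compose])
    then have "(\<lambda>z. (1 - cnj l * z) * k z) \<in> A" using k(3) by (simp add: A_def)
    from gmax[OF this] have "cmod (1 - cnj l * z0) * cmod (k z0) \<le> cmod (z0 - l) * cmod (k z0)"
      using k(2)[OF z0(1)] by (simp add: norm_mult)
    moreover have "cmod (k z0) > 0" using gz0 k(2)[OF z0(1)] by auto
    ultimately have "cmod (1 - cnj l * z0) \<le> cmod (z0 - l)" by simp
    with Blaschke_factor_lt_1[of l z0] l z0(1) show False by simp
  qed
  \<comment> \<open>The square root of a zero-free function of modulus at most 1 is larger, so it is
      a better competitor unless \<open>\<bar>g z0\<bar> = 1\<close>.\<close>
  obtain u where u: "u holomorphic_on ball 0 1" "\<And>z. z \<in> ball 0 1 \<Longrightarrow> g z = (u z)\<^sup>2"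
  proof (rule contractible_imp_holomorphic_sqrt[of g "ball 0 1"])
    show "g holomorphic_on ball 0 1" using g(1) by (simp add: Hinf_ball_def)
  qed (use nozero convex_imp_contractible[OF convex_ball] in blast)+
  have ub: "u \<in> Hinf_ball"
    using u g(1) by (auto simp: Hinf_ball_def norm_power power_le_one_iff)
  then have uH: "u \<in> Hinf" by (rule Hinf_ball_Hinf)
  have "\<Phi> (\<lambda>z. u z * u z) = 0"
    using cong[OF Hinf_mult[OF uH uH] Hinf_ball_Hinf[OF g(1)]] u(2) g(2)
    by (simp add: power2_eq_square)
  then have "u \<in> A" using mult_eq_0[OF no uH uH] ub by (simp add: A_def)
  from gmax[OF this] have "cmod (u z0) \<le> cmod (u z0) * cmod (u z0)"
    using u(2)[OF z0(1)] by (simp add: power2_eq_square flip: norm_mult)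
  moreover have "cmod (u z0) > 0" using gz0 u(2)[OF z0(1)] by auto
  ultimately have "1 \<le> cmod (u z0)" by simp
  then have "1 \<le> cmod (g z0)" using u(2)[OF z0(1)] by (simp add: norm_power one_le_power)
  then have le: "cmod (g z) \<le> cmod (g z0)" if "z \<in> ball 0 1" for z
    using Hinf_ball_norm_le[OF g(1), of z] that by simp
  have "g constant_on ball 0 1"
    using g(1) le z0(1)
    by (intro maximum_modulus_principle[of g "ball 0 1" "ball 0 1" z0]) (auto simp: Hinf_ball_def)
  then have const: "g z = g z0 * 1" if "z \<in> ball 0 1" for z
    using that z0(1) by (auto simp: constant_on_def)
  have "\<Phi> g = \<Phi> (\<lambda>z. g z0 * 1)"
    by (intro cong Hinf_mult Hinf_const Hinf_ball_Hinf[OF g(1)] const)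
  then have "g z0 *\<^sub>C h = 0"
    using scale[OF Hinf_const[of 1], of "g z0" h] g(2) by (simp add: one)
  then show False using gz0 h(1) by (auto simp: complex_vector.scale_eq_0_iff)
qed

end
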